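(* Let $N\geq 3$ be an integer, let $A>0$, $0<\alpha<2$ and $$\frac{2N}{N-\alpha}<p\leq 2\,\frac{2N-2+\alpha}{2N-2-\alpha}.$$ Then there is no radial function $u$ that is a (classical) solution of the problem $$-\triangle u+\frac{A}{|x|^{\alpha}}u=u^{p-1}\ \text{ in }\mathbb{R}^{N}\setminus\{0\},\qquad u>0\ \text{ in }\mathbb{R}^{N}\setminus\{0\},\qquad u\in H_{\alpha}^{1}\cap L^{p}(\mathbb{R}^{N}).$$
   Context: Here $D^{1,2}(\mathbb{R}^{N})=\{u\in L^{2^{*}}(\mathbb{R}^{N}):\nabla u\in L^{2}(\mathbb{R}^{N})\}$ with $2^{*}=2N/(N-2)$ (gradient in the weak sense), and $H_{\alpha}^{1}:=D^{1,2}(\mathbb{R}^{N})\cap L^{2}(\mathbb{R}^{N},|x|^{-\alpha}dx)$. "Solution" means classical solution: $u\in C^{2}(\mathbb{R}^{N}\setminus\{0\})$ satisfying the equation pointwise in $\mathbb{R}^{N}\setminus\{0\}$ together with the positivity and integrability conditions. "Radial" means $u(x)=\phi(|x|)$ for some function $\phi:(0,+\infty)\to\mathbb{R}$. *)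

theory Defs
  imports "HOL-Analysis.Analysis"
begin

text \<open>The \<open>b\<close>-th partial derivative, for \<open>b \<in> Basis\<close>. It is meaningful only where \<open>f\<close> is
  differentiable.\<close>

definition partial_deriv :: "'a::euclidean_space \<Rightarrow> ('a \<Rightarrow> real) \<Rightarrow> 'a \<Rightarrow> real" where
  "partial_deriv b f x = frechet_derivative f (at x) b"

definition laplacian :: "('a::euclidean_space \<Rightarrow> real) \<Rightarrow> 'a \<Rightarrow> real" where
  "laplacian f x = (\<Sum>b\<in>Basis. partial_deriv b (partial_deriv b f) x)"

text \<open>Membership in \<open>C\<^sup>k(S)\<close>; intended for open \<open>S\<close>, since the derivatives are the unrestricted
  ones.\<close>

primrec Ck_on :: "nat \<Rightarrow> ('a::euclidean_space \<Rightarrow> real) \<Rightarrow> 'a set \<Rightarrow> bool" where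
  "Ck_on 0 f S \<longleftrightarrow> continuous_on S f"
| "Ck_on (Suc k) f S \<longleftrightarrow>
     (\<forall>x\<in>S. f differentiable (at x)) \<and> (\<forall>b\<in>Basis. Ck_on k (partial_deriv b f) S)"

definition test_function :: "('a::euclidean_space \<Rightarrow> real) \<Rightarrow> bool" where
  "test_function \<phi> \<longleftrightarrow> (\<forall>k. Ck_on k \<phi> UNIV) \<and> compact (closure {x. \<phi> x \<noteq> 0})"

text \<open>Functions are not identified up to null sets; every condition below is invariant under
  changing the function on a null set, except for the pointwise ones on the complement of \<open>0\<close>.\<close>

definition Lp_space :: "real \<Rightarrow> 'a measure \<Rightarrow> ('a \<Rightarrow> 'b::euclidean_space) set" where
  "Lp_space p M = {f \<in> borel_measurable M. integrable M (\<lambda>x. norm (f x) powr p)}"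

definition locally_integrable :: "('a::euclidean_space \<Rightarrow> 'b::euclidean_space) \<Rightarrow> bool" where
  "locally_integrable f \<longleftrightarrow> (\<forall>K. compact K \<longrightarrow> f absolutely_integrable_on K)"

text \<open>Local integrability is required because the Bochner integral of a non-integrable function
  is \<open>0\<close>.\<close>

definition has_weak_gradient ::
    "('a::euclidean_space \<Rightarrow> real) \<Rightarrow> ('a \<Rightarrow> 'a) \<Rightarrow> bool" where
  "has_weak_gradient u g \<longleftrightarrow>
     locally_integrable u \<and> locally_integrable g \<and>
     (\<forall>\<phi>. test_function \<phi> \<longrightarrow> (\<forall>b\<in>Basis.
        (\<integral>x. u x * partial_deriv b \<phi> x \<partial>lebesgue) = - (\<integral>x. (g x \<bullet> b) * \<phi> x \<partial>lebesgue)))"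

definition critical_exponent :: "'a::euclidean_space itself \<Rightarrow> real" where
  "critical_exponent _ = 2 * real DIM('a) / (real DIM('a) - 2)"

definition D12 :: "('a::euclidean_space \<Rightarrow> real) set" where
  "D12 = {u \<in> Lp_space (critical_exponent TYPE('a)) lebesgue.
            \<exists>g. has_weak_gradient u g \<and> g \<in> Lp_space 2 lebesgue}"

definition H1 :: "real \<Rightarrow> ('a::euclidean_space \<Rightarrow> real) set" where
  "H1 \<alpha> = D12 \<inter> Lp_space 2 (density lebesgue (\<lambda>x. ennreal (norm x powr (- \<alpha>))))"

text \<open>A function on the complement of \<open>0\<close> is modelled by a total one whose value at \<open>0\<close> is
  irrelevant.\<close>

definition radial :: "('a::euclidean_space \<Rightarrow> real) \<Rightarrow> bool" where
  "radial u \<longleftrightarrow> (\<exists>\<phi> :: real \<Rightarrow> real. \<forall>x. x \<noteq> 0 \<longrightarrow> u x = \<phi> (norm x))"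

definition classical_solution ::
    "real \<Rightarrow> real \<Rightarrow> real \<Rightarrow> ('a::euclidean_space \<Rightarrow> real) \<Rightarrow> bool" where
  "classical_solution A \<alpha> p u \<longleftrightarrow>
     Ck_on 2 u (- {0}) \<and>
     (\<forall>x. x \<noteq> 0 \<longrightarrow> - laplacian u x + A / norm x powr \<alpha> * u x = u x powr (p - 1)) \<and>
     (\<forall>x. x \<noteq> 0 \<longrightarrow> u x > 0) \<and>
     u \<in> H1 \<alpha> \<inter> Lp_space p lebesgue"

end

theory Submission
  imports Defs
begin

text \<open>A radial solution \<open>u x = f \<bar>x\<bar>\<close> in dimension \<open>n\<close> has a positive profile with
  \<open>f'' + (n - 1) / r * f' = A * r powr -\<alpha> * f - f powr (p - 1)\<close> on \<open>(0, \<infinity>)\<close>. Multiplying this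
  equation by \<open>r powr a * f'\<close> and by \<open>r powr (a - 1) * f\<close> and combining the results gives a
  weighted Pohozaev identity: with \<open>a = n - 1 + \<alpha> / 2\<close> and suitable \<open>b, c, k > 0\<close> the function

  \<open>E = r powr a * (f'\<^sup>2 / 2 - A * r powr -\<alpha> * f\<^sup>2 / 2 + f powr p / p + b * f * f' / r + c * f\<^sup>2 / r\<^sup>2)\<close>

  satisfies \<open>E' = r powr a * ((a / p - b) * f powr p / r + k * f\<^sup>2 / r ^ 3)\<close>. The two free
  parameters \<open>a\<close> and \<open>b\<close> are used to cancel the terms in \<open>f'\<^sup>2\<close> and in \<open>r powr -\<alpha> * f\<^sup>2\<close>, and then
  \<open>a / p - b \<ge> 0\<close> is exactly the upper bound on \<open>p\<close>. Hence \<open>E\<close> is strictly increasing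
  (\<open>energy_strict_mono\<close>), and it remains to see that its behaviour at both ends forbids this.

  Near \<open>0\<close> (\<open>energy_pos_somewhere\<close>): since \<open>c > 0\<close> and \<open>\<alpha> < 2\<close>, \<open>E\<close> is positive at any small \<open>r\<close>
  at which \<open>- r * f' / f\<close> is small. If there were no such point, \<open>f\<close> would be decreasing near \<open>0\<close>,
  so integrability of \<open>u powr (2 * n / (n - 2))\<close> would give \<open>f = O(r powr -((n - 2) / 2))\<close>. As \<open>p\<close> is below the Sobolev
  exponent, the nonlinear term is then a small perturbation and \<open>f\<close> would have to blow up almost as
  fast as the fundamental solution \<open>r powr (2 - n)\<close>, contradicting that bound. So \<open>E\<close> is positive
  somewhere and bounded below by a positive constant from there on.

  Near infinity (\<open>profile_impossible\<close>): \<open>E\<close> is at most a constant times \<open>r\<close> times the density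
  \<open>q = r powr (n - 1) * (f'\<^sup>2 + r powr -\<alpha> * f\<^sup>2 + f powr p)\<close>, so \<open>q\<close> has infinite integral at
  infinity. The terms of \<open>q\<close> without \<open>f'\<close> are integrable, so the flux \<open>r powr (n - 1) * f * f'\<close>,
  whose derivative is \<open>r powr (n - 1) * f'\<^sup>2\<close> up to integrable terms, tends to infinity. Then \<open>f\<close> is
  eventually increasing, which is impossible for a positive profile of an \<open>L\<^sup>p\<close> function.\<close>

section \<open>Integrals of radial functions\<close>

text \<open>Integration of radial functions in polar coordinates. Both sides give the interval
  \<open>{..a}\<close> the volume of a ball of radius \<open>a\<close> (zero for negative \<open>a\<close>), and these intervals generate the Borel sets.\<close>

lemma distr_norm_lborel:
  "distr (lborel :: 'a::euclidean_space measure) borel norm =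
    density lborel (\<lambda>r. ennreal (indicator {0..} r *
      (real DIM('a) * unit_ball_vol DIM('a) * r ^ (DIM('a) - 1))))" (is "?M = ?N")
proof (rule measure_eqI_generator_eq)
  let ?d = "real DIM('a)" and ?w = "unit_ball_vol DIM('a)"
  let ?E = "range (\<lambda>a::real. {..a})"
  show "Int_stable ?E" by (auto simp: Int_stable_def)
  show "?E \<subseteq> Pow UNIV" by simp
  show "sets ?M = sigma_sets UNIV ?E" "sets ?N = sigma_sets UNIV ?E"
    by (simp_all add: borel_eq_atMost)
  have M: "emeasure ?M {..a} = (if 0 \<le> a then ennreal (?w * a ^ DIM('a)) else 0)" for a
  proof -
    have "norm -` {..a} = (cball 0 a :: 'a set)" by (auto simp: dist_norm)
    then have "emeasure ?M {..a} = emeasure lborel (cball 0 a :: 'a set)"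
      by (simp add: emeasure_distr)
    then show ?thesis by (simp add: emeasure_cball)
  qed
  have N: "emeasure ?N {..a} = (if 0 \<le> a then ennreal (?w * a ^ DIM('a)) else 0)" for a
  proof -
    have "emeasure ?N {..a} = (\<integral>\<^sup>+r. ennreal (?d * ?w * r ^ (DIM('a) - 1)) * indicator {0..a} r \<partial>lborel)"
      by (subst emeasure_density)
        (auto intro!: nn_integral_cong simp: indicator_def)
    also have "\<dots> = (if 0 \<le> a then ennreal (?w * a ^ DIM('a)) else 0)"
    proof (cases "0 \<le> a")
      case True
      have "(\<integral>\<^sup>+r. ennreal (?d * ?w * r ^ (DIM('a) - 1)) * indicator {0..a} r \<partial>lborel)
        = ennreal (?w * a ^ DIM('a) - ?w * 0 ^ DIM('a))"
        using True by (intro nn_integral_FTC_Icc)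
          (auto intro!: derivative_eq_intros)
      then show ?thesis using True by simp
    qed simp
    finally show ?thesis .
  qed
  show "emeasure ?M X = emeasure ?N X" if "X \<in> ?E" for X using that M N by auto
  show "range (\<lambda>i::nat. {..real i}) \<subseteq> ?E" by auto
  show "(\<Union>i::nat. {..real i}) = UNIV" using real_arch_simple by auto
  show "emeasure ?M {..real i} \<noteq> \<infinity>" for i unfolding M by simp
qed

text \<open>The form in which integrability on the whole space reaches the profile equation: a bound on
  the ordinary integrals over compact intervals, uniform in their end points.\<close>

lemma radial_integral_bounded:
  fixes g :: "'a::euclidean_space \<Rightarrow> real" and k :: "real \<Rightarrow> real"
  assumes int: "integrable lebesgue g"
    and g: "\<And>x. x \<noteq> 0 \<Longrightarrow> g x = k (norm x)"
    and cont: "continuous_on {0<..} k" and nonneg: "\<And>r. 0 < r \<Longrightarrow> 0 \<le> k r"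
  shows "\<exists>K. \<forall>x y. 0 < x \<longrightarrow> x \<le> y \<longrightarrow> integral {x..y} (\<lambda>r. r powr (real DIM('a) - 1) * k r) \<le> K"
proof -
  define k0 where "k0 r = indicator {0<..} r *\<^sub>R k r" for r
  have k0[measurable]: "k0 \<in> borel_measurable borel"
    unfolding k0_def[abs_def] using cont by (intro borel_measurable_continuous_on_indicator) auto
  define W where "W = real DIM('a) * unit_ball_vol DIM('a)"
  have W: "0 < W" by (simp add: W_def)
  have "(\<integral>\<^sup>+x. ennreal (norm (g x)) \<partial>lebesgue) < \<infinity>"
    using int by (simp add: integrable_iff_bounded)
  moreover have "(\<integral>\<^sup>+x. ennreal (norm (g x)) \<partial>lebesgue) = (\<integral>\<^sup>+x. ennreal (k0 (norm (x::'a))) \<partial>lebesgue)"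
  proof (rule nn_integral_cong_AE)
    have "AE x in lborel. x \<noteq> (0::'a)" by (rule AE_lborel_singleton)
    then have "AE x in lebesgue. x \<noteq> (0::'a)" by (rule AE_completion)
    then show "AE x in lebesgue. ennreal (norm (g x)) = ennreal (k0 (norm x))"
      by eventually_elim (use g nonneg in \<open>simp add: k0_def\<close>)
  qed
  ultimately have fin: "(\<integral>\<^sup>+x. ennreal (k0 (norm (x::'a))) \<partial>lborel) < \<infinity>"
    by (simp add: nn_integral_completion)
  \<comment> \<open>Only Borel functions can be transported by \<open>norm\<close>; this is why \<open>k\<close> was cut off to \<open>k0\<close>.\<close>
  have polar: "(\<integral>\<^sup>+x. ennreal (k0 (norm (x::'a))) \<partial>lborel)
    = (\<integral>\<^sup>+r. ennreal (indicator {0..} r * (W * r ^ (DIM('a) - 1))) * ennreal (k0 r) \<partial>lborel)"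
  proof -
    have "(\<integral>\<^sup>+x. ennreal (k0 (norm (x::'a))) \<partial>lborel)
      = (\<integral>\<^sup>+r. ennreal (k0 r) \<partial>distr (lborel :: 'a measure) borel norm)"
      by (subst nn_integral_distr) auto
    then show ?thesis
      unfolding distr_norm_lborel W_def by (subst (asm) nn_integral_density) auto
  qed
  obtain K where K: "0 \<le> K" "(\<integral>\<^sup>+x. ennreal (k0 (norm (x::'a))) \<partial>lborel) = ennreal K"
    using fin by (cases "\<integral>\<^sup>+x. ennreal (k0 (norm (x::'a))) \<partial>lborel") auto
  have "integral {x..y} (\<lambda>r. r powr (real DIM('a) - 1) * k r) \<le> K / W" if xy: "0 < x" "x \<le> y" for x y
  proof -
    let ?h = "\<lambda>r. W * (r powr (real DIM('a) - 1) * k r)"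
    have "continuous_on {x..y} k" using xy by (intro continuous_on_subset[OF cont]) auto
    then have "?h integrable_on {x..y}"
      using xy by (intro integrable_continuous_interval continuous_on_mult continuous_on_powr
          continuous_on_id continuous_on_const) auto
    then have hi: "(?h has_integral integral {x..y} ?h) {x..y}" by (rule integrable_integral)
    have "ennreal (integral {x..y} ?h) = (\<integral>\<^sup>+r. ennreal (?h r) * indicator {x..y} r \<partial>lborel)"
      using xy nonneg W by (intro nn_integral_has_integral_lebesgue'[symmetric] hi) simp
    also have "\<dots> \<le> (\<integral>\<^sup>+r. ennreal (indicator {0..} r * (W * r ^ (DIM('a) - 1))) * ennreal (k0 r) \<partial>lborel)"
    proof (rule nn_integral_mono)
      fix r :: real
      have "r powr (real DIM('a) - 1) = r ^ (DIM('a) - 1)" if "0 < r"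
        using that by (subst powr_realpow[symmetric]) (auto simp: of_nat_diff DIM_ge_Suc0)
      then show "ennreal (?h r) * indicator {x..y} r
        \<le> ennreal (indicator {0..} r * (W * r ^ (DIM('a) - 1))) * ennreal (k0 r)"
        using xy W nonneg[of r]
        by (auto simp: indicator_def k0_def ennreal_mult[symmetric] mult_ac)
    qed
    also have "\<dots> = ennreal K" using polar K by simp
    finally have "W * integral {x..y} (\<lambda>r. r powr (real DIM('a) - 1) * k r) \<le> K"
      using K by simp
    then show ?thesis using W by (simp add: field_simps)
  qed
  then show ?thesis by blast
qed

section \<open>The Laplacian of a radial function\<close>

lemma norm_has_derivative:
  fixes x :: "'a::euclidean_space"
  assumes "x \<noteq> 0"
  shows "(norm has_derivative (\<lambda>v. (x \<bullet> v) / norm x)) (at x)"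
  using has_derivative_norm[OF assms]
  by (simp add: sgn_div_norm inner_commute divide_inverse mult.commute)

lemma radial_has_derivative:
  fixes x :: "'a::euclidean_space"
  assumes f: "(f has_real_derivative d) (at (norm x))" and x: "x \<noteq> 0"
  shows "((\<lambda>x. f (norm x)) has_derivative (\<lambda>v. d * ((x \<bullet> v) / norm x))) (at x)"
  using has_derivative_compose[OF norm_has_derivative[OF x], of f "\<lambda>h. d * h"] f
  by (simp add: has_field_derivative_def)

lemma radial_partial_deriv:
  fixes u :: "'a::euclidean_space \<Rightarrow> real"
  assumes u: "\<And>x. x \<noteq> 0 \<Longrightarrow> u x = f (norm x)"
    and f: "\<And>r. 0 < r \<Longrightarrow> (f has_real_derivative f1 r) (at r)"
    and x: "x \<noteq> 0"
  shows "partial_deriv v u x = f1 (norm x) * ((x \<bullet> v) / norm x)"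
proof -
  have "((\<lambda>x. f (norm x)) has_derivative (\<lambda>v. f1 (norm x) * ((x \<bullet> v) / norm x))) (at x)"
    using f[of "norm x"] x by (intro radial_has_derivative) auto
  then have "(u has_derivative (\<lambda>v. f1 (norm x) * ((x \<bullet> v) / norm x))) (at x)"
    using x u by (rule_tac has_derivative_transform_within_open[where s = "- {0}"]) auto
  then show ?thesis unfolding partial_deriv_def by (simp add: frechet_derivative_at[symmetric])
qed

text \<open>Differentiating \<open>f' \<bar>x\<bar> * (x \<bullet> b) / \<bar>x\<bar>\<close> once more in the direction \<open>b\<close> and summing over the
  basis, the squares \<open>(x \<bullet> b)\<^sup>2\<close> add up to \<open>\<bar>x\<bar>\<^sup>2\<close>: the radial direction contributes \<open>f''\<close> and each of
  the remaining dimensions contributes \<open>f' / r\<close>.\<close>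

lemma radial_laplacian:
  fixes u :: "'a::euclidean_space \<Rightarrow> real"
  assumes u: "\<And>x. x \<noteq> 0 \<Longrightarrow> u x = f (norm x)"
    and f: "\<And>r. 0 < r \<Longrightarrow> (f has_real_derivative f1 r) (at r)"
    and f1: "\<And>r. 0 < r \<Longrightarrow> (f1 has_real_derivative f2 r) (at r)"
    and x: "x \<noteq> 0"
  shows "laplacian u x = f2 (norm x) + (real DIM('a) - 1) / norm x * f1 (norm x)"
proof -
  let ?r = "norm x"
  have r: "0 < ?r" using x by simp
  have "partial_deriv b (partial_deriv b u) x
      = f2 ?r * (x \<bullet> b)\<^sup>2 / ?r\<^sup>2 + f1 ?r * (1 / ?r - (x \<bullet> b)\<^sup>2 / ?r ^ 3)" if b: "b \<in> Basis" for b
  proof -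
    let ?D = "\<lambda>v. f2 ?r * ((x \<bullet> v) / ?r) * ((x \<bullet> b) / ?r)
      + f1 ?r * ((v \<bullet> b) / ?r - (x \<bullet> b) * ((x \<bullet> v) / ?r) / ?r\<^sup>2)"
    note N = norm_has_derivative[OF x]
    have F: "((\<lambda>x. f1 (norm x)) has_derivative (\<lambda>v. f2 ?r * ((x \<bullet> v) / ?r))) (at x)"
      using f1[OF r] x by (rule radial_has_derivative)
    have "((\<lambda>x. f1 (norm x) * ((x \<bullet> b) / norm x)) has_derivative ?D) (at x)"
      using r by (auto intro!: derivative_eq_intros F N simp: field_simps power2_eq_square)
    then have "(partial_deriv b u has_derivative ?D) (at x)"
      using x by (rule_tac has_derivative_transform_within_open[where s = "- {0}"])
        (auto simp: radial_partial_deriv[OF u f])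
    then have "partial_deriv b (partial_deriv b u) x = ?D b"
      unfolding partial_deriv_def[of b "partial_deriv b u"] by (simp add: frechet_derivative_at[symmetric])
    then show ?thesis using b by (simp add: power2_eq_square power3_eq_cube mult.assoc)
  qed
  then have "laplacian u x = (\<Sum>b\<in>Basis.
      f2 ?r * (x \<bullet> b)\<^sup>2 / ?r\<^sup>2 + f1 ?r * (1 / ?r - (x \<bullet> b)\<^sup>2 / ?r ^ 3))"
    unfolding laplacian_def by simp
  also have "\<dots> = f2 ?r / ?r\<^sup>2 * (\<Sum>b\<in>Basis. (x \<bullet> b)\<^sup>2)
      + f1 ?r * (real DIM('a) / ?r - (\<Sum>b\<in>Basis. (x \<bullet> b)\<^sup>2) / ?r ^ 3)"
    by (simp add: sum.distrib sum_subtractf sum_distrib_left sum_divide_distrib algebra_simps)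
  also have "(\<Sum>b\<in>Basis. (x \<bullet> b)\<^sup>2) = ?r\<^sup>2"
    unfolding power2_norm_eq_inner euclidean_inner[of x x] by (simp add: power2_eq_square)
  finally show ?thesis
    using r by (simp add: field_simps power2_eq_square power3_eq_cube)
qed

section \<open>The weighted energy of a radial profile\<close>

lemma has_real_derivative_powr_self:
  fixes x :: real
  assumes "0 < x"
  shows "((\<lambda>r. r powr s) has_real_derivative s * (x powr s / x)) (at x)"
  using has_real_derivative_powr[OF assms, of s] assms by (simp only: powr_diff powr_one)

text \<open>The algebra behind the derivative of the energy, with \<open>u\<close> for \<open>1 / r\<close>, \<open>g\<close> and \<open>h\<close> for \<open>f\<close> and
  \<open>f'\<close>, \<open>V\<close> for \<open>A * r powr -\<alpha>\<close>, \<open>y\<close> for \<open>f powr (p - 1)\<close> and \<open>i\<close> for \<open>1 / p\<close>, which makes it a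
  polynomial identity. The coefficient of \<open>h\<^sup>2 * u\<close> is \<open>a / 2 - (n - 1) + b\<close> and that of
  \<open>V * g\<^sup>2 * u\<close> is \<open>(\<alpha> - a) / 2 + b\<close>; requiring both to vanish forces the values of \<open>a\<close> and \<open>b\<close>. The
  value of \<open>c\<close> removes the mixed term \<open>g * h * u\<^sup>2\<close>.\<close>

lemma energy_identity:
  fixes n \<alpha> i V y u g h :: real
  assumes "a = n - 1 + \<alpha> / 2" and "b = (n - 1 - \<alpha> / 2) / 2" and "c = b * (1 - \<alpha> / 2) / 2"
    and "k = b * (1 - \<alpha> / 2) * (n - 3 + \<alpha> / 2) / 2"
    and "h' = V * g - y - (n - 1) * u * h"
  shows "a * u * (h\<^sup>2 / 2 - V * g\<^sup>2 / 2 + i * (y * g) + b * g * h * u + c * g\<^sup>2 * u\<^sup>2)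
    + (h * h' + \<alpha> * V * u * g\<^sup>2 / 2 - V * g * h + y * h
    + (b * h\<^sup>2 * u + b * g * h' * u - b * g * h * u\<^sup>2)
    + (2 * c * g * h * u\<^sup>2 - 2 * c * g\<^sup>2 * u ^ 3))
    = (a * i - b) * (y * g) * u + k * g\<^sup>2 * u ^ 3"
proof -
  define \<nu> \<beta> where "\<nu> = n - 1" and "\<beta> = \<alpha> / 2"
  have *: "n = \<nu> + 1" "\<alpha> = 2 * \<beta>" "V * x / 2 = V * x * (1/2)" for x by (simp_all add: \<nu>_def \<beta>_def)
  show ?thesis unfolding assms(1,3,4,5) assms(2) *
    by (simp add: field_simps power2_eq_square power3_eq_cube)
qed

text \<open>The profile equation with explicit first and second derivatives. The dimension enters
  only through real coefficients, so \<open>n\<close> is a real parameter.\<close>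

locale radial_profile =
  fixes n A \<alpha> p :: real and f f1 f2 :: "real \<Rightarrow> real"
  assumes n3: "3 \<le> n" and A_pos: "0 < A" and alpha: "0 < \<alpha>" "\<alpha> < 2" and p2: "2 < p"
    and p_crit: "p * (2 * n - 2 - \<alpha>) \<le> 2 * (2 * n - 2 + \<alpha>)"
    and f_pos: "\<And>r. 0 < r \<Longrightarrow> 0 < f r"
    and f_deriv: "\<And>r. 0 < r \<Longrightarrow> (f has_real_derivative f1 r) (at r)"
    and f1_deriv: "\<And>r. 0 < r \<Longrightarrow> (f1 has_real_derivative f2 r) (at r)"
    and ode: "\<And>r. 0 < r \<Longrightarrow>
      f2 r + (n - 1) / r * f1 r = A * r powr - \<alpha> * f r - f r powr (p - 1)"
begin

text \<open>The weight exponent and the coefficients of the energy; \<open>k\<close> is the coefficient of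
  \<open>f\<^sup>2 / r ^ 3\<close> that survives in its derivative.\<close>

definition a where "a = n - 1 + \<alpha> / 2"
definition b where "b = (n - 1 - \<alpha> / 2) / 2"
definition c where "c = b * (1 - \<alpha> / 2) / 2"
definition k where "k = b * (1 - \<alpha> / 2) * (n - 3 + \<alpha> / 2) / 2"

definition energy :: "real \<Rightarrow> real" where
  "energy r = r powr a * ((f1 r)\<^sup>2 / 2 - A * r powr - \<alpha> * (f r)\<^sup>2 / 2 + f r powr p / p
     + b * f r * f1 r / r + c * (f r)\<^sup>2 / r\<^sup>2)"

lemma b_pos: "0 < b" using n3 alpha by (simp add: b_def)
lemma c_pos: "0 < c" using b_pos alpha by (simp add: c_def)
lemma k_pos: "0 < k" using b_pos alpha n3 by (simp add: k_def)

lemma f2_eq: "0 < r \<Longrightarrow> f2 r = A * r powr - \<alpha> * f r - f r powr p / f r - (n - 1) / r * f1 r"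
  using ode[of r] f_pos[of r] by (simp add: powr_diff algebra_simps)

lemma energy_deriv:
  assumes r: "0 < r"
  shows "(energy has_real_derivative
    r powr a * ((a / p - b) * f r powr p / r + k * (f r)\<^sup>2 / r ^ 3)) (at r)"
proof -
  note [derivative_intros] = f_deriv[OF r] f1_deriv[OF r]
  note pos = f_pos[OF r]
  define u y V where "u = 1 / r" and "y = f r powr p / f r" and "V = A * r powr - \<alpha>"
  have Y: "f r powr p = y * f r" using pos by (simp add: y_def)
  have f2: "f2 r = V * f r - y - (n - 1) * u * f1 r"
    using f2_eq[OF r] by (simp add: u_def y_def V_def)
  define B where "B s = (f1 s)\<^sup>2 / 2 - A * s powr - \<alpha> * (f s)\<^sup>2 / 2 + f s powr p / p
     + b * f s * f1 s / s + c * (f s)\<^sup>2 / s\<^sup>2" for s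
  define B' where "B' = f1 r * f2 r + \<alpha> * V * u * (f r)\<^sup>2 / 2 - V * f r * f1 r + y * f1 r
    + (b * (f1 r)\<^sup>2 * u + b * f r * f2 r * u - b * f r * f1 r * u\<^sup>2)
    + (2 * c * f r * f1 r * u\<^sup>2 - 2 * c * (f r)\<^sup>2 * u ^ 3)"
  have "(B has_real_derivative B') (at r)"
  proof -
    have 1: "((\<lambda>s. (f1 s)\<^sup>2 / 2) has_real_derivative f1 r * f2 r) (at r)"
      by (auto intro!: derivative_eq_intros)
    have W: "((\<lambda>s. A * s powr - \<alpha>) has_real_derivative - \<alpha> * V * u) (at r)"
      by (rule DERIV_cong[OF DERIV_cmult[OF has_real_derivative_powr_self[OF r]]]) (simp add: V_def u_def)
    have F: "((\<lambda>s. (f s)\<^sup>2) has_real_derivative 2 * f r * f1 r) (at r)"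
      by (auto intro!: derivative_eq_intros)
    have 2: "((\<lambda>s. A * s powr - \<alpha> * (f s)\<^sup>2 / 2) has_real_derivative
        - \<alpha> * V * u * (f r)\<^sup>2 / 2 + V * f r * f1 r) (at r)"
      by (rule DERIV_cong[OF DERIV_cdivide[OF DERIV_mult[OF W F]]]) (simp add: V_def add_divide_distrib)
    have 3: "((\<lambda>s. f s powr p / p) has_real_derivative y * f1 r) (at r)"
      using DERIV_cdivide[OF DERIV_chain2[OF has_real_derivative_powr_self[OF pos] f_deriv[OF r]], of p p] p2
      by (simp add: y_def)
    have 4: "((\<lambda>s. b * f s * f1 s / s) has_real_derivative
        b * (f1 r)\<^sup>2 * u + b * f r * f2 r * u - b * f r * f1 r * u\<^sup>2) (at r)"
      using r by (auto intro!: derivative_eq_intros simp: u_def field_simps power2_eq_square)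
    have 5: "((\<lambda>s. c * (f s)\<^sup>2 / s\<^sup>2) has_real_derivative
        2 * c * f r * f1 r * u\<^sup>2 - 2 * c * (f r)\<^sup>2 * u ^ 3) (at r)"
      using r by (auto intro!: derivative_eq_intros simp: u_def field_simps power2_eq_square power3_eq_cube)
    show ?thesis
      unfolding B_def[abs_def]
      by (rule DERIV_cong[OF DERIV_add[OF DERIV_add[OF DERIV_add[OF DERIV_diff[OF 1 2] 3] 4] 5]])
        (simp add: B'_def)
  qed
  from DERIV_mult[OF has_real_derivative_powr_self[OF r, of a] this]
  have "(energy has_real_derivative r powr a * (a * u * B r + B')) (at r)"
    by (simp add: energy_def[abs_def] B_def[abs_def] u_def algebra_simps)
  moreover have "a * u * B r + B' = (a / p - b) * f r powr p / r + k * (f r)\<^sup>2 / r ^ 3"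
  proof -
    have B: "B r = (f1 r)\<^sup>2 / 2 - V * (f r)\<^sup>2 / 2 + (1 / p) * (y * f r) + b * f r * f1 r * u + c * (f r)\<^sup>2 * u\<^sup>2"
      by (simp add: B_def V_def Y u_def power_divide)
    have "a * u * B r + B' = (a * (1 / p) - b) * (y * f r) * u + k * (f r)\<^sup>2 * u ^ 3"
      unfolding B B'_def by (rule energy_identity[OF a_def b_def c_def k_def f2])
    then show ?thesis by (simp add: Y u_def power_divide)
  qed
  ultimately show ?thesis by simp
qed

text \<open>Both terms of the derivative are nonnegative, the first because \<open>p\<close> is at most \<open>a / b\<close>. The
  second one is positive because \<open>0 < \<alpha> < 2\<close> and \<open>n \<ge> 3\<close> make \<open>k\<close> positive.\<close>

lemma energy_strict_mono:
  assumes "0 < r" "r < s" shows "energy r < energy s"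
proof (rule DERIV_pos_imp_increasing[OF assms(2)])
  fix x assume "r \<le> x" "x \<le> s"
  then have x: "0 < x" using assms by simp
  have "0 \<le> a / p - b" using p_crit p2 by (simp add: a_def b_def field_simps)
  then have "0 < x powr a * ((a / p - b) * f x powr p / x + k * (f x)\<^sup>2 / x ^ 3)"
    using x f_pos[OF x] k_pos by (intro mult_pos_pos add_nonneg_pos) auto
  then show "\<exists>y. (energy has_real_derivative y) (at x) \<and> 0 < y" using energy_deriv[OF x] by blast
qed

lemma f_continuous: "continuous_on {0<..} f"
  by (auto intro!: continuous_at_imp_continuous_on DERIV_isCont f_deriv)

lemma powr_f_powr_continuous:
  assumes "0 < x" shows "continuous_on {x..y} (\<lambda>r. r powr s * f r powr q)"
proof (intro continuous_on_mult continuous_on_powr continuous_on_id continuous_on_const ballI)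
  show "continuous_on {x..y} f"
    using assms by (intro continuous_on_subset[OF f_continuous]) auto
  show "f r \<noteq> 0" "r \<noteq> 0" if "r \<in> {x..y}" for r using f_pos[of r] that assms by auto
qed

end

section \<open>Behaviour near the origin\<close>

lemma powr_tendsto_0_at_right_0:
  fixes s :: real assumes "0 < s" shows "((\<lambda>r. r powr s) \<longlongrightarrow> 0) (at_right 0)"
proof (rule tendsto_zero_powrI)
  show "((\<lambda>r. r) \<longlongrightarrow> 0) (at_right (0 :: real))" by (rule tendsto_ident_at)
  show "((\<lambda>r. s) \<longlongrightarrow> s) (at_right (0 :: real))" by (rule tendsto_const)
  show "\<forall>\<^sub>F r in at_right 0. 0 \<le> (r :: real)"
    using eventually_at_right_less[of "0 :: real"] by eventually_elim simp
qed (rule assms)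

text \<open>The three integrability conditions on a solution in polar coordinates: for the Sobolev
  exponent, for the weight \<open>r powr -\<alpha>\<close>, and for the exponent \<open>p\<close>.\<close>

locale integrable_radial_profile = radial_profile +
  assumes critical_integral: "\<exists>K. \<forall>x y. 0 < x \<longrightarrow> x \<le> y \<longrightarrow>
      integral {x..y} (\<lambda>r. r powr (n - 1) * f r powr (2 * n / (n - 2))) \<le> K"
    and weighted_integral: "\<exists>K. \<forall>x y. 0 < x \<longrightarrow> x \<le> y \<longrightarrow>
      integral {x..y} (\<lambda>r. r powr (n - 1) * (r powr - \<alpha> * f r powr 2)) \<le> K"
    and Lp_integral: "\<exists>K. \<forall>x y. 0 < x \<longrightarrow> x \<le> y \<longrightarrow>
      integral {x..y} (\<lambda>r. r powr (n - 1) * f r powr p) \<le> K"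
begin

text \<open>A decreasing function is at least \<open>f r\<close> on \<open>[r / 2, r]\<close>, so the integral of its power over
  that interval controls its value at \<open>r\<close>.\<close>

lemma decay_at_0_if_decreasing:
  assumes dec: "\<And>x y. 0 < x \<Longrightarrow> x \<le> y \<Longrightarrow> y < d \<Longrightarrow> f y \<le> f x"
  obtains C where "0 < C" "\<And>r. 0 < r \<Longrightarrow> r < d \<Longrightarrow> f r \<le> C * r powr - ((n - 2) / 2)"
proof -
  define q where "q = 2 * n / (n - 2)"
  have q: "0 < q" "n / q = (n - 2) / 2" using n3 by (auto simp: q_def)
  obtain K where K: "\<And>x y. 0 < x \<Longrightarrow> x \<le> y \<Longrightarrow>
      integral {x..y} (\<lambda>r. r powr (n - 1) * f r powr q) \<le> K"
    using critical_integral unfolding q_def by blast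
  define C where "C = (max K 1 * 2 powr n) powr (1 / q)"
  have "f r \<le> C * r powr - ((n - 2) / 2)" if r: "0 < r" "r < d" for r
  proof -
    have "((r / 2) powr (n - 1) * f r powr q) * (r - r / 2)
        = integral {r/2..r} (\<lambda>s. (r / 2) powr (n - 1) * f r powr q)" using r by simp
    also have "\<dots> \<le> integral {r/2..r} (\<lambda>s. s powr (n - 1) * f s powr q)"
    proof (rule integral_le)
      show "(\<lambda>s. s powr (n - 1) * f s powr q) integrable_on {r/2..r}"
        using r by (intro integrable_continuous_interval powr_f_powr_continuous) simp
      fix s assume s: "s \<in> {r/2..r}"
      show "(r / 2) powr (n - 1) * f r powr q \<le> s powr (n - 1) * f s powr q"
        using s r n3 q f_pos[of r] f_pos[of s] dec[of s r]
        by (intro mult_mono powr_mono2) auto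
    qed auto
    also have "\<dots> \<le> K" using r by (intro K) auto
    finally have "(r / 2) powr n * f r powr q \<le> K"
      using r by (simp add: powr_diff)
    then have "r powr n * f r powr q \<le> K * 2 powr n"
      using r by (simp add: powr_divide field_simps)
    also have "\<dots> \<le> max K 1 * 2 powr n" by (intro mult_right_mono) auto
    finally have "r powr n * f r powr q \<le> max K 1 * 2 powr n" .
    then have "(r powr n * f r powr q) powr (1 / q) \<le> C"
      unfolding C_def using q by (intro powr_mono2) auto
    also have "(r powr n * f r powr q) powr (1 / q) = r powr ((n - 2) / 2) * f r"
      using r f_pos[OF r(1)] q(1) by (simp add: powr_mult powr_powr q(2))
    finally show ?thesis using r by (simp add: powr_minus field_simps)
  qed
  moreover have "0 < C" by (simp add: C_def)
  ultimately show ?thesis using that by blast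
qed

text \<open>Suppose that \<open>- r * f' > w * f\<close> near \<open>0\<close>. The decay bound for decreasing \<open>f\<close> makes
  \<open>r\<^sup>2 * f powr (p - 2)\<close> tend to \<open>0\<close>, because \<open>p\<close> is below the Sobolev exponent. The steepness
  turns this into a bound of the nonlinear term by \<open>\<eta> * (- f') / r\<close>, with \<open>\<eta>\<close> as small as desired,
  and then the equation shows that \<open>- r powr (n - 1 - \<eta>) * f'\<close> does not increase. It is therefore
  bounded away from \<open>0\<close> near the origin, and integration gives growth of \<open>f\<close> like
  \<open>r powr -(n - 2 - \<eta>)\<close>, which is too fast for the decay bound.\<close>

lemma slope_small_near_0:
  assumes d: "0 < d" and w: "0 < w"
  shows "\<exists>r. 0 < r \<and> r < d \<and> - (r * f1 r) \<le> w * f r"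
proof (rule ccontr)
  assume "\<not> ?thesis"
  then have steep: "w * f r < - (r * f1 r)" if "0 < r" "r < d" for r using that by force
  have f1_neg: "f1 r < 0" if "0 < r" "r < d" for r
  proof -
    have "0 < w * f r" using w f_pos that by simp
    then have "r * f1 r < 0" using steep[OF that] by linarith
    then show ?thesis using that by (simp add: mult_less_0_iff)
  qed
  have dec: "f y \<le> f x" if "0 < x" "x \<le> y" "y < d" for x y
    using that f1_neg f_deriv
    by (intro DERIV_nonpos_imp_nonincreasing[OF that(2)]) (meson less_imp_le order_less_le_trans order_le_less_trans)
  obtain C where C: "0 < C" "\<And>r. 0 < r \<Longrightarrow> r < d \<Longrightarrow> f r \<le> C * r powr - ((n - 2) / 2)"
    using decay_at_0_if_decreasing[OF dec] by blast
  \<comment> \<open>Any \<open>\<eta>\<close> strictly between \<open>0\<close> and \<open>(n - 2) / 2\<close> makes \<open>n - 2 - \<eta>\<close> exceed \<open>(n - 2) / 2\<close>.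
    The number \<open>\<beta>\<close> is the power of \<open>r\<close> that bounds \<open>r\<^sup>2 * f powr (p - 2)\<close>.\<close>
  define \<eta> where "\<eta> = (n - 2) / 4"
  define \<beta> where "\<beta> = 2 - (n - 2) / 2 * (p - 2)"
  have \<eta>: "0 < \<eta>" using n3 by (simp add: \<eta>_def)
  have \<beta>: "0 < \<beta>"
  proof -
    have s: "(p - 2) * (2 * n - 2 - \<alpha>) \<le> 4 * \<alpha>" using p_crit by (simp add: algebra_simps)
    have "(n - 1) * \<alpha> < (n - 1) * 2" using n3 alpha by (intro mult_strict_left_mono) auto
    then have t: "(n - 2) * \<alpha> < 2 * n - 2 - \<alpha>" by (simp add: algebra_simps)
    have "(n - 2) * ((p - 2) * (2 * n - 2 - \<alpha>)) \<le> (n - 2) * (4 * \<alpha>)"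
      using s n3 by (intro mult_left_mono) auto
    also have "\<dots> < 4 * (2 * n - 2 - \<alpha>)" using t by simp
    finally have "(n - 2) * (p - 2) * (2 * n - 2 - \<alpha>) < 4 * (2 * n - 2 - \<alpha>)" by (simp add: mult.assoc)
    then have "(n - 2) * (p - 2) < 4" using n3 alpha by (subst (asm) mult_less_cancel_right_pos) auto
    then show ?thesis by (simp add: \<beta>_def)
  qed
  have "((\<lambda>r. C powr (p - 2) * r powr \<beta>) \<longlongrightarrow> C powr (p - 2) * 0) (at_right 0)"
    by (intro tendsto_intros powr_tendsto_0_at_right_0 \<beta>)
  then have "\<forall>\<^sub>F r in at_right 0. C powr (p - 2) * r powr \<beta> < w * \<eta>"
    using w \<eta> by (intro order_tendstoD) auto
  then obtain d1 where d1: "0 < d1" "\<And>r. 0 < r \<Longrightarrow> r < d1 \<Longrightarrow> C powr (p - 2) * r powr \<beta> < w * \<eta>"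
    unfolding eventually_at_right_field by auto
  define r1 where "r1 = min d d1 / 2"
  have r1: "0 < r1" "r1 < d" "r1 < d1" using d d1 by (auto simp: r1_def)
  have small: "f r powr (p - 1) \<le> w * \<eta> * f r / r\<^sup>2" if r: "0 < r" "r \<le> r1" for r
  proof -
    have "f r powr (p - 2) \<le> (C * r powr - ((n - 2) / 2)) powr (p - 2)"
      using r r1 f_pos[OF r(1)] p2 C(2)[of r] by (intro powr_mono2) auto
    also have "\<dots> = C powr (p - 2) * r powr (\<beta> - 2)"
      using C r by (simp add: powr_mult powr_powr \<beta>_def)
    also have "\<dots> = C powr (p - 2) * r powr \<beta> / r\<^sup>2"
      using r by (simp add: powr_diff)
    also have "\<dots> \<le> w * \<eta> / r\<^sup>2"
      using d1(2)[of r] r r1 by (intro divide_right_mono) auto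
    finally have "f r powr (p - 2) * f r \<le> w * \<eta> / r\<^sup>2 * f r"
      using f_pos[OF r(1)] by (intro mult_right_mono) auto
    moreover have "f r powr (p - 1) = f r powr (p - 2) * f r"
      using f_pos[OF r(1)] by (simp add: powr_diff power2_eq_square)
    ultimately show ?thesis by simp
  qed
  define y where "y r = - (r powr (n - 1 - \<eta>) * f1 r)" for r
  have y_mono: "y r1 \<le> y r" if r: "0 < r" "r \<le> r1" for r
  proof (rule DERIV_nonpos_imp_nonincreasing[OF r(2)])
    fix s assume "r \<le> s" "s \<le> r1"
    then have s: "0 < s" "s \<le> r1" "s < d" using r r1 by auto
    have P: "((\<lambda>r. r powr (n - 1 - \<eta>)) has_real_derivative
        (n - 1 - \<eta>) * (s powr (n - 1 - \<eta>) / s)) (at s)"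
      using s(1) by (rule has_real_derivative_powr_self)
    have D: "(y has_real_derivative
      s powr (n - 1 - \<eta>) * (- f2 s - (n - 1) / s * f1 s + \<eta> * f1 s / s)) (at s)"
      unfolding y_def[abs_def]
    proof (rule DERIV_cong[OF DERIV_minus[OF DERIV_mult[OF P f1_deriv[OF s(1)]]]])
      have "- ((n - 1 - \<eta>) * (T / s) * g + h * T) = T * (- h - (n - 1) / s * g + \<eta> * g / s)" for T g h
        using s by (simp add: field_simps)
      then show "- ((n - 1 - \<eta>) * (s powr (n - 1 - \<eta>) / s) * f1 s + f2 s * s powr (n - 1 - \<eta>))
          = s powr (n - 1 - \<eta>) * (- f2 s - (n - 1) / s * f1 s + \<eta> * f1 s / s)" .
    qed
    have "0 \<le> A * s powr - \<alpha> * f s" using A_pos f_pos[OF s(1)] by simp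
    then have "- f2 s - (n - 1) / s * f1 s \<le> w * \<eta> * f s / s\<^sup>2"
      using ode[OF s(1)] small[OF s(1,2)] by linarith
    also have "\<dots> = \<eta> / s\<^sup>2 * (w * f s)" by simp
    also have "\<dots> \<le> \<eta> / s\<^sup>2 * (- (s * f1 s))"
      using steep[OF s(1,3)] \<eta> by (intro mult_left_mono) auto
    also have "\<dots> = - (\<eta> * f1 s / s)" using s by (simp add: power2_eq_square)
    finally have "s powr (n - 1 - \<eta>) * (- f2 s - (n - 1) / s * f1 s + \<eta> * f1 s / s) \<le> 0"
      by (intro mult_nonneg_nonpos) auto
    with D show "\<exists>z. (y has_real_derivative z) (at s) \<and> z \<le> 0" by blast
  qed
  define e where "e = y r1"
  have e: "0 < e" using f1_neg[OF r1(1,2)] r1 by (simp add: e_def y_def mult_pos_neg)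
  define m where "m = n - 2 - \<eta>"
  have m: "0 < m" "0 < m - (n - 2) / 2" using n3 by (auto simp: m_def \<eta>_def field_simps)
  have lower: "e / m * r powr - m - e / m * r1 powr - m \<le> f r" if r: "0 < r" "r \<le> r1" for r
  proof -
    have "f r1 - e / m * r1 powr - m \<le> f r - e / m * r powr - m"
    proof (rule DERIV_nonpos_imp_nonincreasing[OF r(2)])
      fix s assume "r \<le> s" "s \<le> r1"
      then have s: "0 < s" "s \<le> r1" using r by auto
      note [derivative_intros] = f_deriv[OF s(1)]
      have "((\<lambda>s. f s - e / m * s powr - m) has_real_derivative f1 s + e * s powr (- m - 1)) (at s)"
        using s m by (auto intro!: derivative_eq_intros)
      moreover have "f1 s + e * s powr (- m - 1) \<le> 0"
      proof -
        have "e * s powr (- m - 1) \<le> y s * s powr (- m - 1)"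
          using y_mono[OF s] by (auto simp: e_def intro!: mult_right_mono)
        also have "\<dots> = - f1 s * (s powr (n - 1 - \<eta>) * s powr (- m - 1))" by (simp add: y_def)
        also have "\<dots> = - f1 s" using s by (simp add: powr_add[symmetric] m_def)
        finally show ?thesis by simp
      qed
      ultimately show "\<exists>z. ((\<lambda>s. f s - e / m * s powr - m) has_real_derivative z) (at s) \<and> z \<le> 0"
        by blast
    qed
    then show ?thesis using f_pos[OF r1(1)] by linarith
  qed
  have "((\<lambda>r. C * r powr (m - (n - 2) / 2) + e / m * r1 powr - m * r powr m) \<longlongrightarrow>
      C * 0 + e / m * r1 powr - m * 0) (at_right 0)"
    by (intro tendsto_intros powr_tendsto_0_at_right_0 m)
  then have "\<forall>\<^sub>F r in at_right 0. C * r powr (m - (n - 2) / 2) + e / m * r1 powr - m * r powr m < e / m"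
    using e m by (intro order_tendstoD) auto
  then obtain d2 where d2: "0 < d2" "\<And>r. 0 < r \<Longrightarrow> r < d2 \<Longrightarrow>
      C * r powr (m - (n - 2) / 2) + e / m * r1 powr - m * r powr m < e / m"
    unfolding eventually_at_right_field by auto
  define r where "r = min r1 d2 / 2"
  have r: "0 < r" "r \<le> r1" "r < d" "r < d2" using r1 d2(1) by (auto simp: r_def)
  have "(e / m * r powr - m - e / m * r1 powr - m) * r powr m \<le> C * r powr - ((n - 2) / 2) * r powr m"
    using lower[OF r(1,2)] C(2)[OF r(1,3)] by (intro mult_right_mono) auto
  also have "\<dots> = C * r powr (m - (n - 2) / 2)"
    by (simp only: mult.assoc powr_add[symmetric]) (simp add: algebra_simps)
  finally have "e / m * (r powr - m * r powr m) \<le> C * r powr (m - (n - 2) / 2) + e / m * r1 powr - m * r powr m"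
    by (simp add: algebra_simps)
  moreover have "r powr - m * r powr m = 1" using r by (simp add: powr_add[symmetric])
  ultimately show False using d2(2)[OF r(1,4)] by simp
qed

text \<open>Up to the factor \<open>r powr a / r\<^sup>2\<close> the energy contains \<open>c * f\<^sup>2\<close>. The only terms that can be
  negative are \<open>b * f * (r * f')\<close> and \<open>A * r powr (2 - \<alpha>) * f\<^sup>2 / 2\<close>; where the slope and \<open>r\<close> are
  small, each of them takes away at most a quarter of \<open>c * f\<^sup>2\<close>.\<close>

lemma energy_pos_somewhere: "\<exists>r>0. 0 < energy r"
proof -
  have "((\<lambda>r. A * r powr (2 - \<alpha>)) \<longlongrightarrow> A * 0) (at_right 0)"
    using alpha by (intro tendsto_intros powr_tendsto_0_at_right_0) auto
  then have "\<forall>\<^sub>F r in at_right 0. A * r powr (2 - \<alpha>) < c / 2"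
    using c_pos by (intro order_tendstoD) auto
  then obtain d where d: "0 < d" "\<And>r. 0 < r \<Longrightarrow> r < d \<Longrightarrow> A * r powr (2 - \<alpha>) < c / 2"
    unfolding eventually_at_right_field by auto
  obtain r where r: "0 < r" "r < d" and slope: "- (r * f1 r) \<le> c / (4 * b) * f r"
    using slope_small_near_0[OF d(1), of "c / (4 * b)"] c_pos b_pos by auto
  have pos: "0 < f r" using f_pos r by simp
  have "energy r = r powr a / r\<^sup>2 * ((r * f1 r)\<^sup>2 / 2 - A * r powr (2 - \<alpha>) * (f r)\<^sup>2 / 2
     + r\<^sup>2 * f r powr p / p + b * f r * (r * f1 r) + c * (f r)\<^sup>2)"
    using r by (simp add: energy_def powr_diff powr_minus field_simps power2_eq_square)
  moreover have "0 < (r * f1 r)\<^sup>2 / 2 - A * r powr (2 - \<alpha>) * (f r)\<^sup>2 / 2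
     + r\<^sup>2 * f r powr p / p + b * f r * (r * f1 r) + c * (f r)\<^sup>2"
  proof -
    have "b * f r * (- (r * f1 r)) \<le> b * f r * (c / (4 * b) * f r)"
      using slope b_pos pos by (intro mult_left_mono) auto
    also have "\<dots> = c / 4 * (f r)\<^sup>2" using b_pos by (simp add: power2_eq_square)
    finally have "- (c / 4 * (f r)\<^sup>2) \<le> b * f r * (r * f1 r)" by simp
    moreover have "A * r powr (2 - \<alpha>) * (f r)\<^sup>2 \<le> c / 2 * (f r)\<^sup>2"
      using d(2)[OF r] by (intro mult_right_mono) auto
    moreover have "0 \<le> r\<^sup>2 * f r powr p / p" "0 \<le> (r * f1 r)\<^sup>2 / 2" using p2 by auto
    moreover have "0 < c * (f r)\<^sup>2" using c_pos pos by simp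
    ultimately show ?thesis by linarith
  qed
  ultimately have "0 < energy r" using r by simp
  then show ?thesis using r by blast
qed

section \<open>Behaviour at infinity\<close>

text \<open>For \<open>r \<ge> 1\<close> the bound \<open>\<alpha> \<le> 2\<close> gives both \<open>r powr a \<le> r * r powr (n - 1)\<close> and
  \<open>1 / r\<^sup>2 \<le> r powr -\<alpha>\<close>, so each term of the energy is dominated by the density.\<close>

lemma energy_le_density:
  assumes r: "1 \<le> r"
  shows "energy r \<le> (1 + b + c) * (r * (r powr (n - 1) * ((f1 r)\<^sup>2 + r powr - \<alpha> * (f r)\<^sup>2 + f r powr p)))"
proof -
  let ?q = "(f1 r)\<^sup>2 + r powr - \<alpha> * (f r)\<^sup>2 + f r powr p"
  have r0: "0 < r" using r by simp
  have a: "r powr a \<le> r * r powr (n - 1)"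
  proof -
    have "r powr a \<le> r powr (1 + (n - 1))" using r alpha by (intro powr_mono) (auto simp: a_def)
    also have "\<dots> = r * r powr (n - 1)" using r by (subst powr_add) simp
    finally show ?thesis .
  qed
  have w: "1 / r\<^sup>2 \<le> r powr - \<alpha>"
  proof -
    have "r powr - 2 \<le> r powr - \<alpha>" using r alpha by (intro powr_mono) auto
    then show ?thesis using r0 by (simp add: powr_minus divide_inverse)
  qed
  have fw: "(f r)\<^sup>2 / r\<^sup>2 \<le> r powr - \<alpha> * (f r)\<^sup>2"
    using mult_right_mono[OF w, of "(f r)\<^sup>2"] by simp
  have cross: "f r * f1 r / r \<le> (f1 r)\<^sup>2 + (f r)\<^sup>2 / r\<^sup>2"
  proof -
    have "0 \<le> (f r / r - f1 r)\<^sup>2" "0 \<le> (f r / r)\<^sup>2" "0 \<le> (f1 r)\<^sup>2" by auto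
    then have "f r / r * f1 r \<le> (f1 r)\<^sup>2 + (f r / r)\<^sup>2" unfolding power2_diff by linarith
    then show ?thesis by (simp add: power_divide)
  qed
  have nn: "0 \<le> f r powr p" "0 \<le> (f1 r)\<^sup>2" "0 \<le> r powr - \<alpha> * (f r)\<^sup>2" by auto
  have "b * f r * f1 r / r \<le> b * ?q"
    using mult_left_mono[of "f r * f1 r / r" ?q b] cross fw nn b_pos by (simp add: mult.assoc)
  moreover have "c * (f r)\<^sup>2 / r\<^sup>2 \<le> c * ?q"
    using mult_left_mono[of "(f r)\<^sup>2 / r\<^sup>2" ?q c] fw nn c_pos by simp
  moreover have "f r powr p / p \<le> f r powr p"
    using p2 nn by (simp add: divide_le_eq mult_le_cancel_left1)
  moreover have "0 \<le> A * r powr - \<alpha> * (f r)\<^sup>2 / 2" using A_pos by simp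
  ultimately have "(f1 r)\<^sup>2 / 2 - A * r powr - \<alpha> * (f r)\<^sup>2 / 2 + f r powr p / p
     + b * f r * f1 r / r + c * (f r)\<^sup>2 / r\<^sup>2 \<le> ?q + b * ?q + c * ?q"
    using nn by linarith
  then have "energy r \<le> r powr a * ((1 + b + c) * ?q)"
    unfolding energy_def by (intro mult_left_mono) (auto simp: algebra_simps)
  also have "\<dots> \<le> (r * r powr (n - 1)) * ((1 + b + c) * ?q)"
    using a b_pos c_pos nn by (intro mult_right_mono mult_nonneg_nonneg add_nonneg_nonneg) auto
  finally show ?thesis by (simp add: mult_ac)
qed

lemma profile_impossible: False
proof -
  obtain r0 where r0: "0 < r0" "0 < energy r0" using energy_pos_somewhere by blast
  define e where "e = energy r0 / (1 + b + c)"
  have e: "0 < e" using r0 b_pos c_pos by (simp add: e_def)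
  define r1 where "r1 = max 2 r0"
  have r1: "2 \<le> r1" "r0 \<le> r1" by (auto simp: r1_def)
  define h where "h r = r powr (n - 1) * (r powr - \<alpha> * f r powr 2) + r powr (n - 1) * f r powr p" for r
  have cont: "continuous_on {x..y} (\<lambda>r. r powr (n - 1) * (r powr - \<alpha> * f r powr 2))"
      "continuous_on {x..y} (\<lambda>r. r powr (n - 1) * f r powr p)" if "0 < x" for x y
    using that by (auto intro!: continuous_on_mult continuous_on_powr powr_f_powr_continuous
        simp: mult.assoc[symmetric] powr_add[symmetric] simp del: powr_numeral)
  obtain K1 where K1: "\<And>x y. 0 < x \<Longrightarrow> x \<le> y \<Longrightarrow>
      integral {x..y} (\<lambda>r. r powr (n - 1) * (r powr - \<alpha> * f r powr 2)) \<le> K1"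
    using weighted_integral by blast
  obtain K2 where K2: "\<And>x y. 0 < x \<Longrightarrow> x \<le> y \<Longrightarrow>
      integral {x..y} (\<lambda>r. r powr (n - 1) * f r powr p) \<le> K2"
    using Lp_integral by blast
  define H where "H y = integral {1..y} h" for y
  have H_le: "H y \<le> K1 + K2" if "1 \<le> y" for y
    using K1[of 1 y] K2[of 1 y] that cont[of 1 y]
    by (simp add: H_def h_def[abs_def] integral_add integrable_continuous_interval)
  have H_deriv: "(H has_real_derivative h r) (at r)" if "1 < r" for r
  proof -
    have "continuous_on {1..r + 1} h" unfolding h_def by (intro continuous_on_add cont) auto
    then have "(H has_real_derivative h r) (at r within {1..r + 1})"
      unfolding H_def[abs_def] using that by (intro integral_has_real_derivative) auto
    then show ?thesis using that by (subst (asm) at_within_Icc_at) auto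
  qed
  \<comment> \<open>The flux. Its derivative is obtained by multiplying the equation by \<open>r powr (n - 1) * f\<close>.\<close>
  define Z where "Z r = r powr (n - 1) * f r * f1 r" for r
  have Z_deriv: "(Z has_real_derivative
      r powr (n - 1) * ((f1 r)\<^sup>2 + A * (r powr - \<alpha> * (f r)\<^sup>2) - f r powr p)) (at r)"
    if r: "0 < r" for r
  proof -
    have P: "((\<lambda>r. r powr (n - 1)) has_real_derivative (n - 1) * (r powr (n - 1) / r)) (at r)"
      using r by (rule has_real_derivative_powr_self)
    have f2: "f r * f2 r = A * (r powr - \<alpha> * (f r)\<^sup>2) - f r powr p - (n - 1) / r * f1 r * f r"
      using r f_pos[OF r] unfolding f2_eq[OF r] by (simp add: field_simps power2_eq_square)
    have *: "((n - 1) * (T / r) * f r + f1 r * T) * f1 r + f2 r * (T * f r)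
        = T * ((f1 r)\<^sup>2 + (n - 1) / r * f1 r * f r + f r * f2 r)" for T
      by (simp add: algebra_simps power2_eq_square)
    show ?thesis
      unfolding Z_def[abs_def]
    proof (rule DERIV_cong[OF DERIV_mult[OF DERIV_mult[OF P f_deriv[OF r]] f1_deriv[OF r]]])
      show "((n - 1) * (r powr (n - 1) / r) * f r + f1 r * r powr (n - 1)) * f1 r
          + f2 r * (r powr (n - 1) * f r)
        = r powr (n - 1) * ((f1 r)\<^sup>2 + A * (r powr - \<alpha> * (f r)\<^sup>2) - f r powr p)"
        unfolding * f2 by simp
    qed
  qed
  \<comment> \<open>Adding \<open>2 * H\<close> compensates the negative term of the derivative of the flux and leaves the full
    density, which dominates \<open>e / r\<close>. As \<open>H\<close> is bounded, monotonicity of \<open>M\<close> makes the flux grow at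
    least like \<open>e * ln r\<close>.\<close>
  define M where "M r = Z r + 2 * H r - e * ln r" for r
  have M_mono: "M r1 \<le> M y" if "r1 \<le> y" for y
  proof (rule DERIV_nonneg_imp_nondecreasing[OF that])
    fix r assume "r1 \<le> r" "r \<le> y"
    then have r: "1 < r" "r0 \<le> r" using r1 by auto
    let ?q = "r powr (n - 1) * ((f1 r)\<^sup>2 + r powr - \<alpha> * (f r)\<^sup>2 + f r powr p)"
    have "energy r0 \<le> energy r" using energy_strict_mono[OF r0(1), of r] r by (cases "r = r0") auto
    also have "\<dots> \<le> (1 + b + c) * (r * ?q)" using energy_le_density r by simp
    finally have "e / r \<le> ?q" using r b_pos c_pos by (simp add: e_def divide_le_eq mult_ac)
    also have "\<dots> \<le> r powr (n - 1) * ((f1 r)\<^sup>2 + A * (r powr - \<alpha> * (f r)\<^sup>2) - f r powr p) + 2 * h r"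
    proof -
      have "0 \<le> r powr (n - 1) * (A * (r powr - \<alpha> * (f r)\<^sup>2))"
        "0 \<le> r powr (n - 1) * (r powr - \<alpha> * (f r)\<^sup>2)" "0 \<le> r powr (n - 1) * f r powr p"
        using A_pos by auto
      then show ?thesis using f_pos[of r] r by (simp add: h_def algebra_simps)
    qed
    finally have "0 \<le> r powr (n - 1) * ((f1 r)\<^sup>2 + A * (r powr - \<alpha> * (f r)\<^sup>2) - f r powr p)
      + 2 * h r - e / r" by simp
    moreover have "(M has_real_derivative r powr (n - 1) *
      ((f1 r)\<^sup>2 + A * (r powr - \<alpha> * (f r)\<^sup>2) - f r powr p) + 2 * h r - e / r) (at r)"
      unfolding M_def[abs_def] using Z_deriv[of r] H_deriv[of r] r
      by (auto intro!: derivative_eq_intros)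
    ultimately show "\<exists>z. (M has_real_derivative z) (at r) \<and> 0 \<le> z" by blast
  qed
  have "\<forall>\<^sub>F r in at_top. (2 * (K1 + K2) - M r1) / e < ln r"
    using ln_at_top by (simp add: filterlim_at_top_dense)
  then obtain R0 where R0: "\<And>r. R0 \<le> r \<Longrightarrow> (2 * (K1 + K2) - M r1) / e < ln r"
    unfolding eventually_at_top_linorder by blast
  define R where "R = max r1 R0"
  have R: "1 < R" using r1 by (auto simp: R_def)
  \<comment> \<open>Beyond \<open>R\<close> the flux is positive, hence so is \<open>f'\<close>.\<close>
  have f1_pos: "0 < f1 r" if "R \<le> r" for r
  proof -
    have r: "r1 \<le> r" "R0 \<le> r" "1 < r" using that R by (auto simp: R_def)
    have "2 * (K1 + K2) - M r1 < e * ln r" using R0[OF r(2)] e by (simp add: divide_less_eq mult.commute)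
    then have "0 < Z r" using M_mono[OF r(1)] H_le[of r] r by (simp add: M_def)
    moreover have "0 < r powr (n - 1) * f r" using f_pos[of r] r by simp
    ultimately show ?thesis unfolding Z_def by (simp only: zero_less_mult_pos)
  qed
  have f_inc: "f R \<le> f r" if "R \<le> r" for r
    using f1_pos f_deriv R
    by (intro DERIV_nonneg_imp_nondecreasing[OF that]) (meson less_imp_le order_less_le_trans zero_less_one order_le_less_trans)
  define F where "F = f R powr p"
  have F: "0 < F" using f_pos[of R] R by (simp add: F_def)
  have "F * (y - R) \<le> K2" if y: "R \<le> y" for y
  proof -
    have "F * (y - R) = integral {R..y} (\<lambda>r. F)" using y by simp
    also have "\<dots> \<le> integral {R..y} (\<lambda>r. r powr (n - 1) * f r powr p)"
    proof (rule integral_le)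
      show "(\<lambda>r. r powr (n - 1) * f r powr p) integrable_on {R..y}"
        using R by (intro integrable_continuous_interval cont) auto
      fix r assume r: "r \<in> {R..y}"
      have "1 * F \<le> r powr (n - 1) * f r powr p"
        using r R n3 f_inc[of r] f_pos[of R] p2 unfolding F_def
        by (intro mult_mono powr_mono2 ge_one_powr_ge_zero) auto
      then show "F \<le> r powr (n - 1) * f r powr p" by simp
    qed auto
    also have "\<dots> \<le> K2" using R y by (intro K2) auto
    finally show ?thesis .
  qed
  from this[of "R + (\<bar>K2\<bar> + 1) / F"] F show False by simp
qed

end

section \<open>From classical solutions to profiles\<close>

lemma partial_deriv_along_ray:
  fixes v :: "'a::euclidean_space \<Rightarrow> real"
  assumes "v differentiable at (r *\<^sub>R e)"
  shows "((\<lambda>r. v (r *\<^sub>R e)) has_real_derivative partial_deriv e v (r *\<^sub>R e)) (at r)"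
proof -
  let ?D = "frechet_derivative v (at (r *\<^sub>R e))"
  have D: "(v has_derivative ?D) (at (r *\<^sub>R e))"
    using assms by (simp add: frechet_derivative_works)
  have ray: "((\<lambda>r. r *\<^sub>R e) has_derivative (\<lambda>h. h *\<^sub>R e)) (at r)"
    by (auto intro!: derivative_eq_intros)
  have "((\<lambda>r. v (r *\<^sub>R e)) has_derivative (\<lambda>h. ?D (h *\<^sub>R e))) (at r)"
    using has_derivative_compose[OF ray D] .
  moreover have "?D (h *\<^sub>R e) = partial_deriv e v (r *\<^sub>R e) * h" for h
    using linear_scale[OF has_derivative_linear[OF D], of h e] by (simp add: partial_deriv_def)
  ultimately show ?thesis by (simp add: has_field_derivative_def)
qed

text \<open>Restricting \<open>u\<close> to the ray through a basis vector \<open>e\<close> gives the profile. Since \<open>u\<close> has two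
  derivatives in the direction \<open>e\<close>, this choice also yields the two derivatives of the profile, which
  the mere existence of some \<open>\<phi>\<close> with \<open>u x = \<phi> \<bar>x\<bar>\<close> does not.\<close>

lemma no_radial_classical_solution:
  fixes u :: "'a::euclidean_space \<Rightarrow> real"
  defines "n \<equiv> real DIM('a)"
  assumes n3: "3 \<le> n" and A: "0 < A" and alpha: "0 < \<alpha>" "\<alpha> < 2"
    and p2: "2 < p" and p_crit: "p * (2 * n - 2 - \<alpha>) \<le> 2 * (2 * n - 2 + \<alpha>)"
    and radial: "radial u" and sol: "classical_solution A \<alpha> p u"
  shows False
proof -
  obtain e :: 'a where e: "e \<in> Basis" using nonempty_Basis by blast
  define f where "f r = u (r *\<^sub>R e)" for r
  define f1 where "f1 r = partial_deriv e u (r *\<^sub>R e)" for r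
  define f2 where "f2 r = partial_deriv e (partial_deriv e u) (r *\<^sub>R e)" for r
  have ray: "r *\<^sub>R e \<noteq> 0" "norm (r *\<^sub>R e) = r" if "0 < r" for r
    using that e by (auto simp: nonzero_Basis)
  have u_f: "u x = f (norm x)" if "x \<noteq> 0" for x
  proof -
    obtain \<phi> where "\<And>x. x \<noteq> 0 \<Longrightarrow> u x = \<phi> (norm x)" using radial by (auto simp: radial_def)
    then show ?thesis using that ray[of "norm x"] by (simp add: f_def)
  qed
  have C2: "u differentiable (at x)" "partial_deriv e u differentiable (at x)" if "x \<noteq> 0" for x
    using sol e that by (auto simp: classical_solution_def numeral_2_eq_2)
  have f: "(f has_real_derivative f1 r) (at r)" if "0 < r" for r
    unfolding f_def[abs_def] f1_def using C2 ray that by (intro partial_deriv_along_ray) auto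
  have f1: "(f1 has_real_derivative f2 r) (at r)" if "0 < r" for r
    unfolding f1_def[abs_def] f2_def using C2 ray that by (intro partial_deriv_along_ray) auto
  have f_pos: "0 < f r" if "0 < r" for r
    using sol ray[OF that] by (auto simp: f_def classical_solution_def)
  interpret radial_profile n A \<alpha> p f f1 f2
  proof
    fix r :: real assume r: "0 < r"
    have "- laplacian u (r *\<^sub>R e) + A / r powr \<alpha> * f r = f r powr (p - 1)"
      using sol ray[OF r] unfolding classical_solution_def f_def by metis
    moreover have "laplacian u (r *\<^sub>R e) = f2 r + (n - 1) / r * f1 r"
      using radial_laplacian[OF u_f f f1, of "r *\<^sub>R e"] ray[OF r] by (simp add: n_def)
    ultimately show "f2 r + (n - 1) / r * f1 r = A * r powr - \<alpha> * f r - f r powr (p - 1)"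
      by (simp add: powr_minus divide_inverse)
  qed (use n3 A alpha p2 p_crit f f1 f_pos in auto)
  have powr_cont: "continuous_on {0<..} (\<lambda>r. f r powr q)" for q
    using f_pos by (intro continuous_on_powr f_continuous continuous_on_const) (auto simp: less_imp_neq[THEN not_sym])
  have bound: "\<exists>K. \<forall>x y. 0 < x \<longrightarrow> x \<le> y \<longrightarrow> integral {x..y} (\<lambda>r. r powr (n - 1) * f r powr q) \<le> K"
    if "u \<in> Lp_space q lebesgue" for q
  proof -
    have "integrable lebesgue (\<lambda>x. norm (u x) powr q)" using that by (simp add: Lp_space_def)
    moreover have "norm (u x) powr q = f (norm x) powr q" if "x \<noteq> 0" for x
      using u_f[OF that] f_pos[of "norm x"] that by simp
    ultimately show ?thesis
      unfolding n_def by (rule radial_integral_bounded[where k = "\<lambda>r. f r powr q"]) (auto simp: powr_cont)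
  qed
  have u: "u \<in> D12" "u \<in> Lp_space 2 (density lebesgue (\<lambda>x. ennreal (norm x powr - \<alpha>)))"
    "u \<in> Lp_space p lebesgue"
    using sol by (auto simp: classical_solution_def H1_def)
  interpret integrable_radial_profile n A \<alpha> p f f1 f2
  proof
    have "u \<in> Lp_space (2 * n / (n - 2)) lebesgue"
      using u(1) by (simp add: D12_def critical_exponent_def n_def)
    then show "\<exists>K. \<forall>x y. 0 < x \<longrightarrow> x \<le> y \<longrightarrow>
        integral {x..y} (\<lambda>r. r powr (n - 1) * f r powr (2 * n / (n - 2))) \<le> K" by (rule bound)
    show "\<exists>K. \<forall>x y. 0 < x \<longrightarrow> x \<le> y \<longrightarrow> integral {x..y} (\<lambda>r. r powr (n - 1) * f r powr p) \<le> K"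
      using u(3) by (rule bound)
    have "u \<in> borel_measurable lebesgue" using u(3) by (simp add: Lp_space_def)
    then have "(\<lambda>x. norm (u x) powr 2) \<in> borel_measurable lebesgue" by measurable
    moreover have "(\<lambda>x::'a. norm x powr - \<alpha>) \<in> borel_measurable lebesgue"
      by (intro measurable_completion) simp
    moreover have "integrable (density lebesgue (\<lambda>x. ennreal (norm x powr - \<alpha>))) (\<lambda>x. norm (u x) powr 2)"
      using u(2) unfolding Lp_space_def by blast
    ultimately have "integrable lebesgue (\<lambda>x. norm x powr - \<alpha> *\<^sub>R norm (u x) powr 2)"
      by (subst (asm) integrable_density) auto
    moreover have "norm x powr - \<alpha> *\<^sub>R norm (u x) powr 2 = norm x powr - \<alpha> * f (norm x) powr 2" if "x \<noteq> 0" for x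
      using u_f[OF that] f_pos[of "norm x"] that by simp
    ultimately show "\<exists>K. \<forall>x y. 0 < x \<longrightarrow> x \<le> y \<longrightarrow>
        integral {x..y} (\<lambda>r. r powr (n - 1) * (r powr - \<alpha> * f r powr 2)) \<le> K"
      unfolding n_def
    proof (rule radial_integral_bounded[where k = "\<lambda>r. r powr - \<alpha> * f r powr 2"])
      show "continuous_on {0<..} (\<lambda>r. r powr - \<alpha> * f r powr 2)"
        by (intro continuous_on_mult powr_cont continuous_on_powr continuous_on_id continuous_on_const) auto
    qed auto
  qed
  show False by (rule profile_impossible)
qed

theorem theorem2:
  fixes N :: nat and A \<alpha> p :: real
  assumes "CARD('n::finite) = N" and "N \<ge> 3"
    and "A > 0" and "0 < \<alpha>" and "\<alpha> < 2"
    and "2 * real N / (real N - \<alpha>) < p"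
    and "p \<le> 2 * ((2 * real N - 2 + \<alpha>) / (2 * real N - 2 - \<alpha>))"
  shows "\<not> (\<exists>u :: real ^ 'n \<Rightarrow> real. radial u \<and> classical_solution A \<alpha> p u)"
proof (intro notI, elim exE conjE)
  fix u :: "real ^ 'n \<Rightarrow> real"
  assume u: "radial u" "classical_solution A \<alpha> p u"
  have N: "real N = real DIM(real ^ 'n)" using assms(1) by simp
  have n3: "3 \<le> real N" using assms(2) by simp
  show False
  proof (rule no_radial_classical_solution[OF _ _ _ _ _ _ u])
    have "2 \<le> 2 * real N / (real N - \<alpha>)" using assms(4,5) n3 by (simp add: le_divide_eq)
    then show "2 < p" using assms(6) by linarith
    have "0 < 2 * real N - 2 - \<alpha>" using assms(5) n3 by linarith
    then show "p * (2 * real DIM(real ^ 'n) - 2 - \<alpha>) \<le> 2 * (2 * real DIM(real ^ 'n) - 2 + \<alpha>)"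
      using assms(7) unfolding N[symmetric] times_divide_eq_right by (simp only: pos_le_divide_eq)
    show "3 \<le> real DIM(real ^ 'n)" using n3 unfolding N .
  qed (rule assms)+
qed

end
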